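(* Let the pair $(\Delta_{m-1},C)$ satisfy (S1)–(S4) with $r=1$, let $\pi^\ast\in\Sigma$ be the reference distribution, and write $\psi(\gamma)=\varphi(\gamma)\,\mathbf n$ for the response line (with $\mathbf n\in\mathbb R^m$ a fixed vector spanning $V$ and $\varphi:(0,1)\to\mathbb R$). Suppose the Wronskians $\mathcal W[\varphi,s(z;\cdot)]$ keep a common strict sign $\varepsilon\in\{\pm1\}$ on $(0,1)$ at every site $z$, neutral sites included. (This is strictly stronger than the vertex condition (V), which constrains only the two sites of each orbit.) Then for every $\pi\in\Delta_{m-1}^\circ$ and every $\gamma\in(0,1)$, $$\operatorname{sgn}\partial_\gamma C(\pi,\gamma)=\varepsilon\,\operatorname{sgn}\langle\pi-\pi^\ast,\mathbf n\rangle :$$ the map $\gamma\mapsto C(\pi,\gamma)$ is strictly monotone off $\Sigma$ and constant on it, with direction determined once and for all by the side of the separatrix. (Here $\langle\pi-\pi^\ast,\mathbf n\rangle=0$ cuts out a hyperplane of $\mathbb R^m$, and $\Sigma=\{\pi\in\Delta_{m-1}:\langle\pi-\pi^\ast,\mathbf n\rangle=0\}$ is its trace on the simplex.) In particular the qualitative content of the global orientation conjecture, namely a single $\gamma$-independent orientation of the simplex, organised by $\Sigma$, holds whenever $r=1$.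
   Context: Let $m\ge2$ and let $Z=\{z_1,\dots,z_m\}$ be a set of $m$ distinct sites; coordinates of $\mathbb R^m$ are indexed by $Z$, and $\langle\cdot,\cdot\rangle$ is the standard pairing. $\Delta_{m-1}=\{\pi\in\mathbb R^m:\pi_z\ge0,\ \sum_z\pi_z=1\}$, with relative interior $\Delta_{m-1}^\circ$ (all $\pi_z>0$). The function $C:\Delta_{m-1}\times(0,1)\to\mathbb R$ is smooth. The conditions are: (S1) for each $\gamma\in(0,1)$, $\pi\mapsto C(\pi,\gamma)$ is $\mathcal C^1$ on $\Delta^\circ_{m-1}$ and extends continuously to the boundary; (S2) $C(\pi,\gamma)=\sum_z\pi_zu(z;\gamma)/\sum_z\pi_zs(z;\gamma)$ with denominator strictly positive on $\Delta_{m-1}\times(0,1)$, where $u(z;\gamma)=\sum_{\nu=1}^Nf_\nu(\gamma)A_\nu(z)$, $s(z;\gamma)=\sum_{\nu=1}^Nf_\nu(\gamma)(A_\nu(z)+B_\nu(z))$, the $f_\nu$ are real-analytic and linearly independent on $(0,1)$, and the matrix $(A_\nu(z_i))\in\mathbb R^{N\times m}$ has full column rank $m\le N$; (S3) there are an involution $\sigma$ of $Z$ with at least one non-trivial pair, and weights $\kappa(z)>0$ independent of $\nu$, with $B_\nu(z)=\kappa(z)A_\nu(\sigma(z))$ for all $\nu,z$; (S4) there is $K>0$ with $\kappa(z)\kappa(\sigma(z))=K$ for all $z$. An orbit is a pair $\{z,\sigma(z)\}$ with $\sigma(z)\ne z$; a neutral site is a fixed point of $\sigma$. Put $C^\ast=1/(1+\sqrt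 K)$, $\psi_z(\gamma)=u(z;\gamma)-C^\ast s(z;\gamma)$, $V=\operatorname{span}\{\psi(\gamma):\gamma\in(0,1)\}\subseteq\mathbb R^m$, $r=\dim V$. The separatrix is $\Sigma=\{\pi\in\Delta_{m-1}: C(\pi,\gamma)\text{ is constant in }\gamma\}$; the reference distribution $\pi^\ast$ is a point fixed once and for all in $\Sigma\cap\Delta_{m-1}^\circ$. For functions $\varphi,s$ of $\gamma$, $\mathcal W[\varphi,s]=\varphi's-\varphi s'$. Vertex condition (V): in each orbit $O$ fix a representative $z_O$ and let $\mathbf d_O\in\mathbb R^m$ have component $\sqrt{\kappa(z_O)}$ at $z_O$, $-\sqrt{\kappa(\sigma(z_O))}$ at $\sigma(z_O)$, and $0$ elsewhere; under (S2)–(S4) one has $\psi(\gamma)=\sum_O\varphi_O(\gamma)\mathbf d_O$ for unique scalar functions $\varphi_O$. (V) requires an $\varepsilon\in\{\pm1\}$ with $\varepsilon\,\mathcal W[\varphi_O,s(z;\cdot)](\gamma)>0$ for all $\gamma\in(0,1)$, every orbit $O$ and both $z\in O$. The global orientation conjecture asserts that under (S1)–(S4), $\operatorname{sgn}\partial_\gamma C(\pi,\gamma)=\operatorname{sgn}\langle\pi-\pi^\ast,\psi(\gamma)\rangle$ for all $\pi\in\Delta_{m-1}^\circ$, $\gamma\in(0,1)$. *)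

theory Defs
  imports "HOL-Analysis.Analysis"
begin

section \<open>Differentiability classes and real-analytic functions\<close>

primrec Ck_open :: "nat \<Rightarrow> 'a::euclidean_space set \<Rightarrow> ('a \<Rightarrow> real) \<Rightarrow> bool" where
  "Ck_open 0 U f \<longleftrightarrow> continuous_on U f"
| "Ck_open (Suc k) U f \<longleftrightarrow> f differentiable_on U \<and>
     (\<forall>b\<in>Basis. Ck_open k U (\<lambda>x. frechet_derivative f (at x) b))"

text \<open>On a set that need not be open (the simplex has empty interior in the ambient space),
  being of class \<open>C\<^sup>k\<close> or smooth means being the restriction of such a function
  defined on an open neighbourhood.\<close>

definition Ck_on :: "nat \<Rightarrow> 'a::euclidean_space set \<Rightarrow> ('a \<Rightarrow> real) \<Rightarrow> bool" where
  "Ck_on k S f \<longleftrightarrow>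
     (\<exists>U g. open U \<and> S \<subseteq> U \<and> Ck_open k U g \<and> (\<forall>x\<in>S. g x = f x))"

definition smooth_on :: "'a::euclidean_space set \<Rightarrow> ('a \<Rightarrow> real) \<Rightarrow> bool" where
  "smooth_on S f \<longleftrightarrow>
     (\<exists>U g. open U \<and> S \<subseteq> U \<and> (\<forall>k. Ck_open k U g) \<and> (\<forall>x\<in>S. g x = f x))"

definition real_analytic_on :: "(real \<Rightarrow> real) \<Rightarrow> real set \<Rightarrow> bool" where
  "real_analytic_on f S \<longleftrightarrow>
     (\<forall>x\<in>S. \<exists>r>0. \<exists>a. \<forall>y. \<bar>y - x\<bar> < r \<longrightarrow> (\<lambda>n. a n * (y - x) ^ n) sums f y)"

definition wronskian :: "(real \<Rightarrow> real) \<Rightarrow> (real \<Rightarrow> real) \<Rightarrow> real \<Rightarrow> real" where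
  "wronskian \<phi> s \<gamma> = deriv \<phi> \<gamma> * s \<gamma> - \<phi> \<gamma> * deriv s \<gamma>"

section \<open>The simplex and the structural conditions\<close>

text \<open>Sites are the elements of a finite type \<open>'z\<close>, so \<open>m = CARD('z)\<close>; the index \<open>\<nu>\<close>
  ranges over a finite type \<open>'n\<close>, so \<open>N = CARD('n)\<close>.\<close>

definition prob_simplex :: "(real ^ 'z::finite) set" where
  "prob_simplex = {\<pi>. (\<forall>z. 0 \<le> \<pi> $ z) \<and> (\<Sum>z\<in>UNIV. \<pi> $ z) = 1}"

definition open_simplex :: "(real ^ 'z::finite) set" where
  "open_simplex = {\<pi>. (\<forall>z. 0 < \<pi> $ z) \<and> (\<Sum>z\<in>UNIV. \<pi> $ z) = 1}"

definition site_u :: "('n::finite \<Rightarrow> real \<Rightarrow> real) \<Rightarrow> real ^ 'z ^ 'n \<Rightarrow> 'z::finite \<Rightarrow> real \<Rightarrow> real" where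
  "site_u f A z \<gamma> = (\<Sum>\<nu>\<in>UNIV. f \<nu> \<gamma> * A $ \<nu> $ z)"

definition site_s :: "('n::finite \<Rightarrow> real \<Rightarrow> real) \<Rightarrow> real ^ 'z ^ 'n \<Rightarrow> real ^ 'z ^ 'n
    \<Rightarrow> 'z::finite \<Rightarrow> real \<Rightarrow> real" where
  "site_s f A B z \<gamma> = (\<Sum>\<nu>\<in>UNIV. f \<nu> \<gamma> * (A $ \<nu> $ z + B $ \<nu> $ z))"

definition S1 :: "(real ^ 'z::finite \<Rightarrow> real \<Rightarrow> real) \<Rightarrow> bool" where
  "S1 C \<longleftrightarrow> (\<forall>\<gamma>\<in>{0<..<1}.
     Ck_on 1 open_simplex (\<lambda>\<pi>. C \<pi> \<gamma>) \<and> continuous_on prob_simplex (\<lambda>\<pi>. C \<pi> \<gamma>))"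

definition S2 :: "(real ^ 'z::finite \<Rightarrow> real \<Rightarrow> real) \<Rightarrow> ('n::finite \<Rightarrow> real \<Rightarrow> real)
    \<Rightarrow> real ^ 'z ^ 'n \<Rightarrow> real ^ 'z ^ 'n \<Rightarrow> bool" where
  "S2 C f A B \<longleftrightarrow>
     (\<forall>\<pi>\<in>prob_simplex. \<forall>\<gamma>\<in>{0<..<1}.
        0 < (\<Sum>z\<in>UNIV. \<pi> $ z * site_s f A B z \<gamma>) \<and>
        C \<pi> \<gamma> = (\<Sum>z\<in>UNIV. \<pi> $ z * site_u f A z \<gamma>) / (\<Sum>z\<in>UNIV. \<pi> $ z * site_s f A B z \<gamma>)) \<and>
     (\<forall>\<nu>. real_analytic_on (f \<nu>) {0<..<1}) \<and>
     (\<forall>c. (\<forall>\<gamma>\<in>{0<..<1}. (\<Sum>\<nu>\<in>UNIV. c \<nu> * f \<nu> \<gamma>) = 0) \<longrightarrow> (\<forall>\<nu>. c \<nu> = 0)) \<and>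
     rank A = CARD('z) \<and> CARD('z) \<le> CARD('n)"

definition S3 :: "real ^ 'z ^ 'n \<Rightarrow> real ^ 'z ^ 'n \<Rightarrow> ('z::finite \<Rightarrow> 'z) \<Rightarrow> ('z \<Rightarrow> real) \<Rightarrow> bool" where
  "S3 A B \<sigma> \<kappa> \<longleftrightarrow>
     (\<forall>z. \<sigma> (\<sigma> z) = z) \<and> (\<exists>z. \<sigma> z \<noteq> z) \<and> (\<forall>z. 0 < \<kappa> z) \<and>
     (\<forall>\<nu> z. B $ \<nu> $ z = \<kappa> z * A $ \<nu> $ \<sigma> z)"

definition S4 :: "('z \<Rightarrow> 'z) \<Rightarrow> ('z \<Rightarrow> real) \<Rightarrow> real \<Rightarrow> bool" where
  "S4 \<sigma> \<kappa> K \<longleftrightarrow> 0 < K \<and> (\<forall>z. \<kappa> z * \<kappa> (\<sigma> z) = K)"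

definition structured_pair :: "(real ^ 'z::finite \<Rightarrow> real \<Rightarrow> real) \<Rightarrow> ('n::finite \<Rightarrow> real \<Rightarrow> real)
    \<Rightarrow> real ^ 'z ^ 'n \<Rightarrow> real ^ 'z ^ 'n \<Rightarrow> ('z \<Rightarrow> 'z) \<Rightarrow> ('z \<Rightarrow> real) \<Rightarrow> real \<Rightarrow> bool" where
  "structured_pair C f A B \<sigma> \<kappa> K \<longleftrightarrow>
     2 \<le> CARD('z) \<and> smooth_on (prob_simplex \<times> {0<..<1}) (\<lambda>(\<pi>, \<gamma>). C \<pi> \<gamma>) \<and>
     S1 C \<and> S2 C f A B \<and> S3 A B \<sigma> \<kappa> \<and> S4 \<sigma> \<kappa> K"

section \<open>Response space, separatrix and the sign conditions\<close>

definition C_star :: "real \<Rightarrow> real" where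
  "C_star K = 1 / (1 + sqrt K)"

definition response :: "('n::finite \<Rightarrow> real \<Rightarrow> real) \<Rightarrow> real ^ 'z ^ 'n \<Rightarrow> real ^ 'z ^ 'n \<Rightarrow> real
    \<Rightarrow> real \<Rightarrow> real ^ 'z::finite" where
  "response f A B K \<gamma> = (\<chi> z. site_u f A z \<gamma> - C_star K * site_s f A B z \<gamma>)"

definition response_space :: "('n::finite \<Rightarrow> real \<Rightarrow> real) \<Rightarrow> real ^ 'z ^ 'n \<Rightarrow> real ^ 'z ^ 'n \<Rightarrow> real
    \<Rightarrow> (real ^ 'z::finite) set" where
  "response_space f A B K = span (response f A B K ` {0<..<1})"

definition separatrix :: "(real ^ 'z::finite \<Rightarrow> real \<Rightarrow> real) \<Rightarrow> (real ^ 'z) set" where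
  "separatrix C = {\<pi> \<in> prob_simplex. C \<pi> constant_on {0<..<1}}"

text \<open>\<open>R\<close> is a choice of one representative \<open>z\<^sub>O\<close> in each orbit \<open>O = {z, \<sigma> z}\<close>, \<open>\<sigma> z \<noteq> z\<close>.\<close>

definition orbit_reps :: "('z \<Rightarrow> 'z) \<Rightarrow> 'z set \<Rightarrow> bool" where
  "orbit_reps \<sigma> R \<longleftrightarrow>
     (\<forall>z\<in>R. \<sigma> z \<noteq> z) \<and> (\<forall>z. \<sigma> z \<noteq> z \<longrightarrow> (\<exists>!a. a \<in> R \<and> a \<in> {z, \<sigma> z}))"

definition orbit_vector :: "('z::finite \<Rightarrow> 'z) \<Rightarrow> ('z \<Rightarrow> real) \<Rightarrow> 'z \<Rightarrow> real ^ 'z" where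
  "orbit_vector \<sigma> \<kappa> a =
     (\<chi> z. if z = a then sqrt (\<kappa> a) else if z = \<sigma> a then - sqrt (\<kappa> (\<sigma> a)) else 0)"

text \<open>The coefficients \<open>\<phi>\<close> are determined on \<open>{0<..<1}\<close> by the decomposition, since the
  vectors of distinct orbits have disjoint nonempty supports; only these values enter the
  Wronskians.\<close>

definition vertex_condition :: "('n::finite \<Rightarrow> real \<Rightarrow> real) \<Rightarrow> real ^ 'z ^ 'n \<Rightarrow> real ^ 'z ^ 'n
    \<Rightarrow> ('z::finite \<Rightarrow> 'z) \<Rightarrow> ('z \<Rightarrow> real) \<Rightarrow> real \<Rightarrow> 'z set \<Rightarrow> bool" where
  "vertex_condition f A B \<sigma> \<kappa> K R \<longleftrightarrow>
     (\<exists>\<phi> :: 'z \<Rightarrow> real \<Rightarrow> real.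
        (\<forall>\<gamma>\<in>{0<..<1}. response f A B K \<gamma> = (\<Sum>a\<in>R. \<phi> a \<gamma> *\<^sub>R orbit_vector \<sigma> \<kappa> a)) \<and>
        (\<exists>\<epsilon>\<in>{-1, 1}. \<forall>\<gamma>\<in>{0<..<1}. \<forall>a\<in>R. \<forall>z\<in>{a, \<sigma> a}.
           0 < \<epsilon> * wronskian (\<phi> a) (site_s f A B z) \<gamma>))"

definition all_site_condition :: "('n::finite \<Rightarrow> real \<Rightarrow> real) \<Rightarrow> real ^ 'z ^ 'n \<Rightarrow> real ^ 'z ^ 'n
    \<Rightarrow> (real \<Rightarrow> real) \<Rightarrow> real \<Rightarrow> bool" where
  "all_site_condition f A B \<phi> \<epsilon> \<longleftrightarrow>
     \<epsilon> \<in> {-1, 1} \<and>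
     (\<forall>z::'z::finite. \<forall>\<gamma>\<in>{0<..<1}. 0 < \<epsilon> * wronskian \<phi> (site_s f A B z) \<gamma>)"

definition rank_one_pair :: "(real ^ 'z::finite \<Rightarrow> real \<Rightarrow> real) \<Rightarrow> ('n::finite \<Rightarrow> real \<Rightarrow> real)
    \<Rightarrow> real ^ 'z ^ 'n \<Rightarrow> real ^ 'z ^ 'n \<Rightarrow> ('z \<Rightarrow> 'z) \<Rightarrow> ('z \<Rightarrow> real) \<Rightarrow> real
    \<Rightarrow> real ^ 'z \<Rightarrow> real ^ 'z \<Rightarrow> (real \<Rightarrow> real) \<Rightarrow> bool" where
  "rank_one_pair C f A B \<sigma> \<kappa> K \<pi>star n \<phi> \<longleftrightarrow>
     structured_pair C f A B \<sigma> \<kappa> K \<and>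
     dim (response_space f A B K) = 1 \<and>
     \<pi>star \<in> separatrix C \<inter> open_simplex \<and>
     span {n} = response_space f A B K \<and>
     (\<forall>\<gamma>\<in>{0<..<1}. response f A B K \<gamma> = \<phi> \<gamma> *\<^sub>R n)"

text \<open>The qualitative content of the global orientation conjecture: in place of
  \<open>response f A B K \<gamma>\<close> the orienting covector \<open>a\<close> may be any nonzero vector, but it must not
  depend on \<open>\<gamma>\<close>, and its zero hyperplane through \<open>\<pi>star\<close> must cut out the separatrix.\<close>

definition single_orientation :: "(real ^ 'z::finite \<Rightarrow> real \<Rightarrow> real) \<Rightarrow> real ^ 'z \<Rightarrow> bool" where
  "single_orientation C \<pi>star \<longleftrightarrow>
     (\<exists>a. a \<noteq> 0 \<and> separatrix C = {\<pi> \<in> prob_simplex. (\<pi> - \<pi>star) \<bullet> a = 0} \<and>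
        (\<forall>\<pi>\<in>open_simplex. \<forall>\<gamma>\<in>{0<..<1}.
           sgn (deriv (C \<pi>) \<gamma>) = sgn ((\<pi> - \<pi>star) \<bullet> a)))"

end

theory Submission
  imports Defs
begin

text \<open>Since \<open>C - C\<^sup>* = \<phi> \<langle>\<pi>, n\<rangle> / S(\<pi>)\<close> with \<open>S(\<pi>) = \<Sum>\<^sub>z \<pi>\<^sub>z s\<^sub>z\<close>, the quotient rule gives
  \<open>\<partial>\<^sub>\<gamma> C = \<langle>\<pi>, n\<rangle> (\<Sum>\<^sub>z \<pi>\<^sub>z W[\<phi>, s\<^sub>z]) / S(\<pi>)\<^sup>2\<close>, whose sign is that of \<open>\<epsilon> \<langle>\<pi>, n\<rangle>\<close>. Evaluating this
  at \<open>\<pi>\<^sup>*\<close>, where the derivative vanishes, gives \<open>\<langle>\<pi>\<^sup>*, n\<rangle> = 0\<close>, so that \<open>\<langle>\<pi>, n\<rangle> = \<langle>\<pi> - \<pi>\<^sup>*, n\<rangle>\<close>.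
  The full column rank of \<open>A\<close> makes the functions \<open>u\<^sub>z\<close> linearly independent, so \<open>r = 1\<close> leaves
  exactly one orbit and \<open>n\<close> is a multiple of its orbit vector; this yields the vertex condition.\<close>

section \<open>Differentiability classes\<close>

text \<open>\<open>Ck_open\<close> iterates \<open>frechet_derivative\<close>, so agreement of two
  functions has to be carried through every derivative. On an open set this works because a
  derivative depends only on nearby values.\<close>

lemma Ck_open_cong:
  assumes "open U" "\<And>x. x \<in> U \<Longrightarrow> f x = g x"
  shows "Ck_open k U f \<longleftrightarrow> Ck_open k U g"
  using assms(2)
proof (induction k arbitrary: f g)
  case 0
  then show ?case by (simp cong: continuous_on_cong)
next
  case (Suc k)
  \<comment> \<open>Stated for arbitrary functions, since both directions of the equivalence are
    instances of it.\<close>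
  have imp: "Ck_open (Suc k) U h" if fh: "Ck_open (Suc k) U f" "\<And>x. x \<in> U \<Longrightarrow> f x = h x"
    for f h :: "'a \<Rightarrow> real"
  proof -
    have diff: "f differentiable at x" if "x \<in> U" for x
      using fh(1) that assms(1) by (auto simp: differentiable_on_eq_differentiable_at)
    have "h differentiable at x" if "x \<in> U" for x
      using diff[OF that] has_derivative_transform_within_open[of f _ x UNIV U h] assms(1) that fh(2)
      unfolding differentiable_def by metis
    then have "h differentiable_on U"
      using assms(1) by (simp add: differentiable_on_eq_differentiable_at)
    moreover have "frechet_derivative f (at x) = frechet_derivative h (at x)" if "x \<in> U" for x
      using diff[OF that] assms(1) that fh(2) by (rule frechet_derivative_transform_within_open)
    then have "Ck_open k U (\<lambda>x. frechet_derivative h (at x) b)" if "b \<in> Basis" for b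
      using Suc.IH[of "\<lambda>x. frechet_derivative f (at x) b" "\<lambda>x. frechet_derivative h (at x) b"] that fh(1) by simp
    ultimately show ?thesis by simp
  qed
  show ?case
    by (rule iffI; erule imp) (simp_all only: Suc.prems)
qed

text \<open>Derivatives at interior points are unique, so an explicit formula \<open>D\<close> can
  stand in for the chosen \<open>frechet_derivative\<close>.\<close>

lemma Ck_open_SucI:
  assumes "open U" and der: "\<And>x. x \<in> U \<Longrightarrow> (f has_derivative D x) (at x)"
    and "\<And>b. b \<in> Basis \<Longrightarrow> Ck_open k U (\<lambda>x. D x b)"
  shows "Ck_open (Suc k) U f"
proof -
  have "f differentiable_on U"
    using assms(1) der by (auto simp: differentiable_on_eq_differentiable_at differentiable_def)
  moreover have "Ck_open k U (\<lambda>x. frechet_derivative f (at x) b)" if "b \<in> Basis" for b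
  proof -
    have "D x b = frechet_derivative f (at x) b" if "x \<in> U" for x
      using frechet_derivative_at[OF der[OF that]] by simp
    then have "Ck_open k U (\<lambda>x. D x b) \<longleftrightarrow> Ck_open k U (\<lambda>x. frechet_derivative f (at x) b)"
      by (rule Ck_open_cong[OF assms(1)])
    with assms(3)[OF that] show ?thesis by simp
  qed
  ultimately show ?thesis by simp
qed

lemma Ck_open_Suc_has_derivative:
  assumes "open U" "Ck_open (Suc k) U f" "x \<in> U"
  shows "(f has_derivative frechet_derivative f (at x)) (at x)"
  using assms by (auto simp: differentiable_on_eq_differentiable_at frechet_derivative_works)

text \<open>The product and inverse rules mix a function with its derivatives, so the
  undifferentiated factor has to be lowered to class \<open>k\<close>.\<close>

lemma Ck_open_Suc_imp: "Ck_open (Suc k) U f \<Longrightarrow> Ck_open k U f"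
proof (induction k arbitrary: f)
  case 0
  then show ?case by (simp add: differentiable_imp_continuous_on)
next
  case (Suc k)
  then show ?case unfolding Ck_open.simps(2)[of "Suc k"] Ck_open.simps(2)[of k] by blast
qed

lemma Ck_open_const: "open U \<Longrightarrow> Ck_open k U (\<lambda>x. c)"
proof (induction k arbitrary: c)
  case (Suc k)
  then show ?case by (intro Ck_open_SucI[where D="\<lambda>x h. 0"]) auto
qed simp

lemma Ck_open_linear: "open U \<Longrightarrow> bounded_linear f \<Longrightarrow> Ck_open k U f"
proof (induction k)
  case (Suc k)
  then show ?case
    by (intro Ck_open_SucI[where D="\<lambda>x. f"] Ck_open_const) (auto intro: bounded_linear_imp_has_derivative)
qed (simp add: linear_continuous_on)

lemma Ck_open_add:
  "\<lbrakk>open U; Ck_open k U f; Ck_open k U g\<rbrakk> \<Longrightarrow> Ck_open k U (\<lambda>x. f x + g x)"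
proof (induction k arbitrary: f g)
  case 0
  then show ?case by (simp add: continuous_on_add)
next
  case (Suc k)
  note d = Ck_open_Suc_has_derivative[OF Suc.prems(1)]
  show ?case
    by (rule Ck_open_SucI[OF Suc.prems(1) has_derivative_add[OF d d]])
      (use Suc in auto)
qed

lemma Ck_open_mult:
  "\<lbrakk>open U; Ck_open k U f; Ck_open k U g\<rbrakk> \<Longrightarrow> Ck_open k U (\<lambda>x. f x * g x)"
proof (induction k arbitrary: f g)
  case 0
  then show ?case by (simp add: continuous_on_mult)
next
  case (Suc k)
  note d = Ck_open_Suc_has_derivative[OF Suc.prems(1)]
  show ?case
  proof (rule Ck_open_SucI[OF Suc.prems(1) has_derivative_mult[OF d d]])
    fix b :: 'a assume "b \<in> Basis"
    then show "Ck_open k U (\<lambda>x. f x * frechet_derivative g (at x) b + frechet_derivative f (at x) b * g x)"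
      using Suc.prems Ck_open_Suc_imp[OF Suc.prems(2)] Ck_open_Suc_imp[OF Suc.prems(3)]
      by (intro Ck_open_add Suc.IH) auto
  qed (use Suc.prems in auto)
qed

lemma Ck_open_inverse:
  "\<lbrakk>open U; Ck_open k U f; \<And>x. x \<in> U \<Longrightarrow> f x \<noteq> 0\<rbrakk> \<Longrightarrow> Ck_open k U (\<lambda>x. inverse (f x))"
proof (induction k)
  case 0
  then show ?case by (simp add: continuous_on_inverse)
next
  case (Suc k)
  note d = Ck_open_Suc_has_derivative[OF Suc.prems(1,2)]
  show ?case
  proof (rule Ck_open_SucI[OF Suc.prems(1) Deriv.has_derivative_inverse[OF _ d]])
    fix b :: 'a assume "b \<in> Basis"
    \<comment> \<open>The minus sign becomes a constant factor, so that closure under products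
      suffices.\<close>
    then have "Ck_open k U (\<lambda>x. (-1) * (inverse (f x) * frechet_derivative f (at x) b * inverse (f x)))"
      using Suc.prems Suc.IH[OF Suc.prems(1) Ck_open_Suc_imp[OF Suc.prems(2)] Suc.prems(3)]
      by (intro Ck_open_mult Ck_open_const) auto
    then show "Ck_open k U (\<lambda>x. - (inverse (f x) * frechet_derivative f (at x) b * inverse (f x)))"
      by simp
  qed (use Suc.prems in auto)
qed

lemma Ck_open_divide:
  assumes "open U" "Ck_open k U f" "Ck_open k U g" "\<And>x. x \<in> U \<Longrightarrow> g x \<noteq> 0"
  shows "Ck_open k U (\<lambda>x. f x / g x)"
  using Ck_open_mult[OF assms(1,2) Ck_open_inverse[OF assms(1,3,4)]] by (simp add: divide_inverse)

section \<open>Real-analytic functions of one variable\<close>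

lemma real_analytic_on_quadratic: "real_analytic_on (\<lambda>y. p + q * y + r * y\<^sup>2) S"
  unfolding real_analytic_on_def
proof (intro ballI exI conjI allI impI)
  fix x y :: real
  \<comment> \<open>The Taylor coefficients at \<open>x\<close>. The series is a finite sum, so any
    radius works; 1 is taken at the end.\<close>
  let ?a = "\<lambda>n::nat. if n = 0 then p + q * x + r * x\<^sup>2 else if n = 1 then q + 2 * r * x else if n = 2 then r else 0"
  have "(\<lambda>n. ?a n * (y - x) ^ n) sums (\<Sum>n\<in>{0,1,2}. ?a n * (y - x) ^ n)"
    by (rule sums_finite) auto
  also have "(\<Sum>n\<in>{0,1,2}. ?a n * (y - x) ^ n) = p + q * y + r * y\<^sup>2"
    by (simp add: power2_eq_square algebra_simps)
  finally show "(\<lambda>n. ?a n * (y - x) ^ n) sums (p + q * y + r * y\<^sup>2)" .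
qed (rule zero_less_one)

text \<open>The expansion centred at \<open>x\<close> is differentiated termwise at its own centre
  and then translated from 0 to \<open>x\<close>.\<close>

lemma real_analytic_on_imp_differentiable:
  assumes "real_analytic_on f S" "x \<in> S"
  shows "f differentiable at x"
proof -
  obtain r a where r: "0 < r" and a: "\<And>y. \<bar>y - x\<bar> < r \<Longrightarrow> (\<lambda>n. a n * (y - x) ^ n) sums f y"
    using assms unfolding real_analytic_on_def by blast
  have s: "(\<lambda>n. a n * h ^ n) sums f (x + h)" if "norm h < r" for h
    using a[of "x + h"] that by simp
  have "((\<lambda>h. \<Sum>n. a n * h ^ n) has_field_derivative (\<Sum>n. diffs a n * 0 ^ n)) (at 0)"
    using r by (intro termdiffs_strong'[of r] sums_summable[OF s]) auto
  then have "((\<lambda>h. f (x + h)) has_field_derivative (\<Sum>n. diffs a n * 0 ^ n)) (at 0)"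
    by (rule has_field_derivative_transform_within_open[where S="ball 0 r"])
      (use r s in \<open>auto simp: sums_iff\<close>)
  then have "(f has_field_derivative (\<Sum>n. diffs a n * 0 ^ n)) (at (0 + x))"
    unfolding DERIV_shift[of f _ 0 x] by (simp only: add.commute[of x])
  then show ?thesis
    unfolding real_differentiable_def add_0_left by blast
qed

section \<open>Rank-one pairs\<close>

locale rank_one =
  fixes C :: "real ^ 'z::finite \<Rightarrow> real \<Rightarrow> real"
    and f :: "'n::finite \<Rightarrow> real \<Rightarrow> real"
    and A B :: "real ^ 'z ^ 'n"
    and \<sigma> :: "'z \<Rightarrow> 'z"
    and \<kappa> :: "'z \<Rightarrow> real"
    and K :: real
    and \<pi>star n :: "real ^ 'z"
    and \<phi> :: "real \<Rightarrow> real"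
  assumes pair: "rank_one_pair C f A B \<sigma> \<kappa> K \<pi>star n \<phi>"
begin

abbreviation "u \<equiv> site_u f A"
abbreviation "s \<equiv> site_s f A B"

section \<open>Consequences of the structural conditions\<close>

lemma S2: "S2 C f A B" and S3: "S3 A B \<sigma> \<kappa>" and S4: "S4 \<sigma> \<kappa> K"
  using pair by (auto simp: rank_one_pair_def structured_pair_def)

lemma f_independent:
  "(\<And>\<gamma>. \<gamma> \<in> {0<..<1} \<Longrightarrow> (\<Sum>\<nu>\<in>UNIV. c \<nu> * f \<nu> \<gamma>) = 0) \<Longrightarrow> c \<nu> = 0"
  using S2 unfolding S2_def by blast

lemma S_pos: "\<pi> \<in> prob_simplex \<Longrightarrow> \<gamma> \<in> {0<..<1} \<Longrightarrow> 0 < (\<Sum>z\<in>UNIV. \<pi> $ z * site_s f A B z \<gamma>)"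
  and C_quotient: "\<pi> \<in> prob_simplex \<Longrightarrow> \<gamma> \<in> {0<..<1} \<Longrightarrow>
    C \<pi> \<gamma> = (\<Sum>z\<in>UNIV. \<pi> $ z * site_u f A z \<gamma>) / (\<Sum>z\<in>UNIV. \<pi> $ z * site_s f A B z \<gamma>)"
  using S2 unfolding S2_def by blast+

lemma \<sigma>_\<sigma> [simp]: "\<sigma> (\<sigma> z) = z"
  and ex_orbit: "\<exists>z. \<sigma> z \<noteq> z"
  and \<kappa>_pos: "0 < \<kappa> z"
  using S3 by (auto simp: S3_def)

lemma K_pos: "0 < K" and \<kappa>_\<sigma>: "\<kappa> z * \<kappa> (\<sigma> z) = K"
  using S4 by (auto simp: S4_def)

lemma sqrt_K: "sqrt K = sqrt (\<kappa> z) * sqrt (\<kappa> (\<sigma> z))"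
  using \<kappa>_\<sigma>[of z] by (simp flip: real_sqrt_mult)

lemma C_star_pos: "0 < C_star K"
  using K_pos by (simp add: C_star_def add_pos_pos)

lemma response_eq: "\<gamma> \<in> {0<..<1} \<Longrightarrow> response f A B K \<gamma> = \<phi> \<gamma> *\<^sub>R n"
  using pair by (simp add: rank_one_pair_def)

lemma dim_response: "dim (response_space f A B K) = 1"
  and span_n: "span {n} = response_space f A B K"
  using pair by (auto simp: rank_one_pair_def)

lemma n_nonzero: "n \<noteq> 0"
  using dim_response by (auto simp flip: span_n)

text \<open>Otherwise the response space would be zero although it contains \<open>n\<close>. At
  such a point identities for the response can be divided by \<open>\<phi> \<gamma>\<close> and
  become identities for \<open>n\<close>.\<close>

lemma \<phi>_nonzero: obtains \<gamma> where "\<gamma> \<in> {0<..<1}" "\<phi> \<gamma> \<noteq> 0"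
proof (cases "\<exists>\<gamma>\<in>{0<..<1}. \<phi> \<gamma> \<noteq> 0")
  case False
  then have "response f A B K ` {0<..<1} \<subseteq> {0}"
    by (auto simp: response_eq)
  then have "response_space f A B K \<subseteq> span {0}"
    unfolding response_space_def by (rule span_mono)
  then have "n \<in> {0}" using span_base[of n "{n}"] unfolding span_n by auto
  with n_nonzero show ?thesis by simp
qed (use that in blast)

text \<open>The combination equals the sum of the entries of \<open>A *v c\<close> weighted by the
  functions \<open>f \<nu>\<close>. Independence of these functions makes that vector zero, and full
  column rank makes \<open>A\<close> injective.\<close>

lemma site_u_independent:
  assumes "\<And>\<gamma>. \<gamma> \<in> {0<..<1} \<Longrightarrow> (\<Sum>z\<in>UNIV. c z * u z \<gamma>) = 0"
  shows "c z = 0"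
proof -
  have "(\<Sum>\<nu>\<in>UNIV. (A *v (\<chi> z. c z)) $ \<nu> * f \<nu> \<gamma>) = (\<Sum>z\<in>UNIV. c z * u z \<gamma>)" for \<gamma>
    unfolding site_u_def matrix_vector_mult_def
    by (simp add: sum_distrib_left sum_distrib_right mult_ac) (rule sum.swap)
  with assms have "(A *v (\<chi> z. c z)) $ \<nu> = 0" for \<nu>
    using f_independent[of "\<lambda>\<nu>. (A *v (\<chi> z. c z)) $ \<nu>"] by simp
  then have "A *v (\<chi> z. c z) = A *v 0"
    by (simp add: vec_eq_iff)
  moreover have "inj ((*v) A)"
    using S2 by (simp add: S2_def flip: full_rank_injective)
  ultimately have "(\<chi> z. c z) = 0"
    by (rule injD[rotated])
  then show ?thesis by (simp add: vec_eq_iff)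
qed

section \<open>The response and the shape of \<open>n\<close>\<close>

lemma site_s_eq: "s z \<gamma> = u z \<gamma> + \<kappa> z * u (\<sigma> z) \<gamma>"
  using S3 unfolding site_s_def site_u_def S3_def
  by (simp add: distrib_left sum.distrib sum_distrib_left mult_ac)

text \<open>The value of \<open>C_star K\<close> is such that
  \<open>1 - C_star K = C_star K * sqrt K\<close>.\<close>

lemma response_nth:
  "response f A B K \<gamma> $ z = C_star K * (sqrt K * u z \<gamma> - \<kappa> z * u (\<sigma> z) \<gamma>)"
proof -
  have "1 + sqrt K \<noteq> 0" using K_pos by (simp add: add_pos_pos less_imp_neq[symmetric])
  then show ?thesis
    by (simp add: response_def site_s_eq C_star_def field_simps)
qed

text \<open>With p, q the roots of the weights at \<open>z\<close> and \<open>\<sigma> z\<close>,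
  one has sqrt K = p q. The components at \<open>z\<close> and \<open>\<sigma> z\<close> are then
  \<open>C_star K\<close> times p (q u - p u') and q (p u' - q u), where u, u' are the site
  functions there: the same bracket with opposite signs.\<close>

lemma response_\<sigma>:
  "sqrt (\<kappa> z) * response f A B K \<gamma> $ \<sigma> z = - sqrt (\<kappa> (\<sigma> z)) * response f A B K \<gamma> $ z"
proof -
  define p q where "p = sqrt (\<kappa> z)" and "q = sqrt (\<kappa> (\<sigma> z))"
  have k: "\<kappa> z = p * p" "\<kappa> (\<sigma> z) = q * q" "sqrt K = p * q"
    using \<kappa>_pos[of z] \<kappa>_pos[of "\<sigma> z"] by (simp_all add: p_def q_def sqrt_K[of z])
  show ?thesis
    unfolding response_nth \<sigma>_\<sigma> p_def[symmetric] q_def[symmetric]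
    unfolding k by (simp add: algebra_simps)
qed

lemma n_\<sigma>: "sqrt (\<kappa> z) * n $ \<sigma> z = - sqrt (\<kappa> (\<sigma> z)) * n $ z"
proof -
  obtain \<gamma> where \<gamma>: "\<gamma> \<in> {0<..<1}" "\<phi> \<gamma> \<noteq> 0" by (rule \<phi>_nonzero)
  have "\<phi> \<gamma> * (sqrt (\<kappa> z) * n $ \<sigma> z) = \<phi> \<gamma> * (- sqrt (\<kappa> (\<sigma> z)) * n $ z)"
    using response_\<sigma>[of z \<gamma>] by (simp add: response_eq[OF \<gamma>(1)] algebra_simps)
  with \<gamma>(2) show ?thesis by (simp only: mult_cancel_left) simp
qed

text \<open>At a fixed point the antisymmetry equates a positive multiple of the component with its
  negative.\<close>

lemma n_neutral: "\<sigma> z = z \<Longrightarrow> n $ z = 0"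
  using n_\<sigma>[of z] \<kappa>_pos[of z] by simp

text \<open>A zero component would make \<open>sqrt K * u a - \<kappa> a * u (\<sigma> a)\<close>
  vanish on the whole interval, a nontrivial relation between independent functions.\<close>

lemma n_orbit:
  assumes "\<sigma> a \<noteq> a"
  shows "n $ a \<noteq> 0"
proof
  assume "n $ a = 0"
  let ?c = "\<lambda>z. (if z = a then sqrt K else 0) + (if z = \<sigma> a then - \<kappa> a else 0)"
  have "(\<Sum>z\<in>UNIV. ?c z * u z \<gamma>) = 0" if "\<gamma> \<in> {0<..<1}" for \<gamma>
  proof -
    have "C_star K * (\<Sum>z\<in>UNIV. ?c z * u z \<gamma>) = response f A B K \<gamma> $ a"
      by (simp add: response_nth distrib_right sum.distrib if_distrib[of "\<lambda>x. x * _"] cong: if_cong)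
    with \<open>n $ a = 0\<close> C_star_pos show ?thesis by (simp add: response_eq[OF that])
  qed
  then have "?c a = 0" by (rule site_u_independent)
  with assms K_pos show False by simp
qed

text \<open>The \<open>u z\<close> are linearly independent, so two distinct orbits would give two linearly
  independent components of the response, contradicting \<open>r = 1\<close>.\<close>

lemma single_orbit:
  assumes "\<sigma> a \<noteq> a" "\<sigma> b \<noteq> b"
  shows "b \<in> {a, \<sigma> a}"
proof (rule ccontr)
  assume b: "b \<notin> {a, \<sigma> a}"
  then have ab: "a \<noteq> b" "a \<noteq> \<sigma> b" by auto
  \<comment> \<open>Up to the factor \<open>C_star K\<close>, these are the coefficients of n_b
    times component \<open>a\<close> minus n_a times component \<open>b\<close> of the response.
    That difference vanishes because the response is a multiple of \<open>n\<close>.\<close>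
  let ?c = "\<lambda>z. (if z = a then n $ b * sqrt K else 0) + (if z = \<sigma> a then - n $ b * \<kappa> a else 0)
    + (if z = b then - n $ a * sqrt K else 0) + (if z = \<sigma> b then n $ a * \<kappa> b else 0)"
  have "(\<Sum>z\<in>UNIV. ?c z * u z \<gamma>) = 0" if "\<gamma> \<in> {0<..<1}" for \<gamma>
  proof -
    have sum_eq: "(\<Sum>z\<in>UNIV. ?c z * u z \<gamma>)
        = n $ b * sqrt K * u a \<gamma> - n $ b * \<kappa> a * u (\<sigma> a) \<gamma> - n $ a * sqrt K * u b \<gamma> + n $ a * \<kappa> b * u (\<sigma> b) \<gamma>"
      by (simp add: distrib_right sum.distrib if_distrib[of "\<lambda>x. x * _"] cong: if_cong)
    have "C_star K * (\<Sum>z\<in>UNIV. ?c z * u z \<gamma>)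
        = n $ b * response f A B K \<gamma> $ a - n $ a * response f A B K \<gamma> $ b"
      unfolding sum_eq by (simp add: response_nth algebra_simps)
    with C_star_pos show ?thesis by (simp add: response_eq[OF that])
  qed
  \<comment> \<open>Since \<open>a\<close> differs from \<open>\<sigma> a\<close>, \<open>b\<close>
    and \<open>\<sigma> b\<close>, only the first summand survives, and it is nonzero because
    \<open>b\<close> lies in an orbit.\<close>
  then have "?c a = 0" by (rule site_u_independent)
  with assms ab K_pos n_orbit[OF assms(2)] show False by simp
qed

text \<open>The component at \<open>a\<close> fixes the factor, antisymmetry settles
  \<open>\<sigma> a\<close>, and every other site is neutral because there is only one
  orbit.\<close>

lemma n_eq_orbit_vector:
  assumes "\<sigma> a \<noteq> a"
  shows "n = (n $ a / sqrt (\<kappa> a)) *\<^sub>R orbit_vector \<sigma> \<kappa> a"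
proof (rule vec_eq_iff[THEN iffD2], rule allI)
  fix z
  have pos: "sqrt (\<kappa> a) \<noteq> 0" using \<kappa>_pos[of a] by simp
  consider "z = a" | "z = \<sigma> a" | "z \<notin> {a, \<sigma> a}" by blast
  then show "n $ z = ((n $ a / sqrt (\<kappa> a)) *\<^sub>R orbit_vector \<sigma> \<kappa> a) $ z"
  proof cases
    case 2
    then show ?thesis using n_\<sigma>[of a] pos assms by (simp add: orbit_vector_def field_simps)
  next
    case 3
    then have "n $ z = 0" using single_orbit[OF assms, of z] n_neutral by blast
    with 3 show ?thesis by (simp add: orbit_vector_def)
  qed (use pos in \<open>simp add: orbit_vector_def\<close>)
qed

section \<open>Quotient form of \<open>C\<close> and its derivative in
  \<open>\<gamma>\<close>\<close>

lemma differentiable_f: "\<gamma> \<in> {0<..<1} \<Longrightarrow> f \<nu> differentiable at \<gamma>"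
  using S2 real_analytic_on_imp_differentiable unfolding S2_def by blast

lemma differentiable_s: "\<gamma> \<in> {0<..<1} \<Longrightarrow> s z differentiable at \<gamma>"
  unfolding site_s_def[abs_def] by (intro differentiable_sum differentiable_mult differentiable_const ballI)
    (auto intro: differentiable_f)

lemma differentiable_u: "\<gamma> \<in> {0<..<1} \<Longrightarrow> u z differentiable at \<gamma>"
  unfolding site_u_def[abs_def] by (intro differentiable_sum differentiable_mult differentiable_const ballI)
    (auto intro: differentiable_f)

lemma has_derivative_s: "\<gamma> \<in> {0<..<1} \<Longrightarrow> (s z has_field_derivative deriv (s z) \<gamma>) (at \<gamma>)"
  using differentiable_s[of \<gamma> z] by (auto simp: real_differentiable_def dest: DERIV_imp_deriv)

text \<open>Nothing is assumed about the regularity of \<open>\<phi>\<close>; it is recovered by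
  dividing a component of the response by a nonzero component of \<open>n\<close>.\<close>

lemma has_derivative_\<phi>:
  assumes "\<gamma> \<in> {0<..<1}"
  shows "(\<phi> has_field_derivative deriv \<phi> \<gamma>) (at \<gamma>)"
proof -
  obtain z where z: "n $ z \<noteq> 0" using n_nonzero by (auto simp: vec_eq_iff)
  let ?g = "\<lambda>\<gamma>. (u z \<gamma> - C_star K * s z \<gamma>) / n $ z"
  have "?g differentiable at \<gamma>"
    using z by (intro differentiable_divide differentiable_diff differentiable_mult differentiable_const
        differentiable_u differentiable_s assms)
  then obtain D where "(?g has_field_derivative D) (at \<gamma>)" by (auto simp: real_differentiable_def)
  then have "(\<phi> has_field_derivative D) (at \<gamma>)"
  proof (rule has_field_derivative_transform_within_open[OF _ _ assms])
    fix x :: real assume "x \<in> {0<..<1}"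
    then show "?g x = \<phi> x"
      using z arg_cong[OF response_eq[of x], of "\<lambda>v. v $ z"] by (simp add: response_def)
  qed simp
  then show ?thesis by (simp add: DERIV_imp_deriv)
qed

abbreviation "S \<pi> \<gamma> \<equiv> (\<Sum>z\<in>UNIV. \<pi> $ z * s z \<gamma>)"

lemma C_eq:
  assumes "\<pi> \<in> prob_simplex" "\<gamma> \<in> {0<..<1}"
  shows "C \<pi> \<gamma> = C_star K + (\<pi> \<bullet> n) * \<phi> \<gamma> / S \<pi> \<gamma>"
proof -
  have "(\<pi> \<bullet> n) * \<phi> \<gamma> = \<pi> \<bullet> response f A B K \<gamma>"
    by (simp add: response_eq[OF assms(2)])
  also have "\<dots> = (\<Sum>z\<in>UNIV. \<pi> $ z * u z \<gamma>) - C_star K * S \<pi> \<gamma>"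
    by (simp add: inner_vec_def response_def algebra_simps sum_subtractf sum_distrib_left)
  finally show ?thesis
    using C_quotient[OF assms] S_pos[OF assms] by (simp add: field_simps)
qed

lemma has_derivative_C:
  assumes "\<pi> \<in> prob_simplex" "\<gamma> \<in> {0<..<1}"
  shows "(C \<pi> has_field_derivative
    (\<pi> \<bullet> n) * (\<Sum>z\<in>UNIV. \<pi> $ z * wronskian \<phi> (s z) \<gamma>) / (S \<pi> \<gamma>)\<^sup>2) (at \<gamma>)"
proof -
  have W: "(\<Sum>z\<in>UNIV. \<pi> $ z * wronskian \<phi> (s z) \<gamma>)
      = deriv \<phi> \<gamma> * S \<pi> \<gamma> - \<phi> \<gamma> * (\<Sum>z\<in>UNIV. \<pi> $ z * deriv (s z) \<gamma>)"
    by (simp add: wronskian_def algebra_simps sum_subtractf sum_distrib_left)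
  have "(S \<pi> has_field_derivative (\<Sum>z\<in>UNIV. \<pi> $ z * deriv (s z) \<gamma>)) (at \<gamma>)"
    by (intro DERIV_sum DERIV_cmult has_derivative_s assms)
  note quotient = DERIV_divide[OF DERIV_cmult[OF has_derivative_\<phi>[OF assms(2)], of "\<pi> \<bullet> n"] this]
  have "((\<lambda>\<gamma>. C_star K + (\<pi> \<bullet> n) * \<phi> \<gamma> / S \<pi> \<gamma>) has_field_derivative
    (\<pi> \<bullet> n) * (\<Sum>z\<in>UNIV. \<pi> $ z * wronskian \<phi> (s z) \<gamma>) / (S \<pi> \<gamma>)\<^sup>2) (at \<gamma>)"
    unfolding W
    by (rule derivative_eq_intros quotient refl)+
      (use S_pos[OF assms] in \<open>simp_all add: power2_eq_square algebra_simps\<close>)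
  \<comment> \<open>The closed form is known only on the open unit interval, so the derivative is
    transferred locally.\<close>
  then show ?thesis
    by (rule has_field_derivative_transform_within_open[OF _ _ assms(2)]) (simp_all add: C_eq[OF assms(1)])
qed

end

section \<open>Signs and monotonicity under the Wronskian hypothesis\<close>

locale oriented_rank_one = rank_one +
  fixes \<epsilon> :: real
  assumes all_site: "all_site_condition f A B \<phi> \<epsilon>"
begin

lemma \<epsilon>_cases: "\<epsilon> = -1 \<or> \<epsilon> = 1"
  and wronskian_sign: "\<gamma> \<in> {0<..<1} \<Longrightarrow> 0 < \<epsilon> * wronskian \<phi> (s z) \<gamma>"
  using all_site by (auto simp: all_site_condition_def)

text \<open>The weights are nonnegative with sum 1, so some weight is positive. As the Wronskians
  share one strict sign at all sites, that single weight suffices, also on the boundary of the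
  simplex.\<close>

lemma C_derivative_sign:
  assumes "\<pi> \<in> prob_simplex" "\<gamma> \<in> {0<..<1}"
  obtains q where "0 < q" "(C \<pi> has_field_derivative \<epsilon> * (\<pi> \<bullet> n) * q) (at \<gamma>)"
proof
  let ?W = "\<Sum>z\<in>UNIV. \<pi> $ z * (\<epsilon> * wronskian \<phi> (s z) \<gamma>)"
  have \<pi>: "0 \<le> \<pi> $ z" "(\<Sum>z\<in>UNIV. \<pi> $ z) = 1" for z
    using assms(1) by (auto simp: prob_simplex_def)
  then obtain w where "\<pi> $ w \<noteq> 0"
    by (metis sum.neutral zero_neq_one)
  then have "0 < \<pi> $ w * (\<epsilon> * wronskian \<phi> (s w) \<gamma>)"
    using \<pi>(1)[of w] by (intro mult_pos_pos[OF _ wronskian_sign[OF assms(2)]]) simp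
  moreover have "0 \<le> \<pi> $ z * (\<epsilon> * wronskian \<phi> (s z) \<gamma>)" for z
    by (rule mult_nonneg_nonneg[OF \<pi>(1) less_imp_le[OF wronskian_sign[OF assms(2)]]])
  ultimately have "0 < ?W"
    by (intro sum_pos2[of UNIV w]) auto
  then show "0 < ?W / (S \<pi> \<gamma>)\<^sup>2"
    using S_pos[OF assms] by simp
  have "?W = \<epsilon> * (\<Sum>z\<in>UNIV. \<pi> $ z * wronskian \<phi> (s z) \<gamma>)"
    by (simp add: sum_distrib_left mult_ac)
  moreover have "\<epsilon> * \<epsilon> = 1" using \<epsilon>_cases by auto
  ultimately have eq: "\<epsilon> * (\<pi> \<bullet> n) * (?W / (S \<pi> \<gamma>)\<^sup>2)
      = (\<pi> \<bullet> n) * (\<Sum>z\<in>UNIV. \<pi> $ z * wronskian \<phi> (s z) \<gamma>) / (S \<pi> \<gamma>)\<^sup>2"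
    by (simp add: mult.assoc[symmetric])
  show "(C \<pi> has_field_derivative \<epsilon> * (\<pi> \<bullet> n) * (?W / (S \<pi> \<gamma>)\<^sup>2)) (at \<gamma>)"
    unfolding eq using has_derivative_C[OF assms] .
qed

text \<open>A constant function has derivative 0, while the sign formula gives a nonzero multiple of
  \<open>\<pi> \<bullet> n\<close>; one point of the interval is enough, here 1/2. Conversely
  \<open>C \<pi>\<close> reduces to \<open>C_star K\<close>.\<close>

lemma separatrix_iff:
  assumes "\<pi> \<in> prob_simplex"
  shows "\<pi> \<in> separatrix C \<longleftrightarrow> \<pi> \<bullet> n = 0"
proof
  assume "\<pi> \<in> separatrix C"
  then obtain c where c: "\<And>\<gamma>. \<gamma> \<in> {0<..<1} \<Longrightarrow> c = C \<pi> \<gamma>"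
    by (auto simp: separatrix_def constant_on_def)
  have half: "1/2 \<in> {0<..<1::real}" by simp
  obtain q where q: "0 < q" "(C \<pi> has_field_derivative \<epsilon> * (\<pi> \<bullet> n) * q) (at (1/2))"
    by (rule C_derivative_sign[OF assms half])
  have "(C \<pi> has_field_derivative 0) (at (1/2))"
    by (rule has_field_derivative_transform_within_open[OF DERIV_const[of c] _ half c]) auto
  with q(2) have "\<epsilon> * (\<pi> \<bullet> n) * q = 0" by (rule DERIV_unique)
  with q(1) \<epsilon>_cases show "\<pi> \<bullet> n = 0" by auto
next
  assume "\<pi> \<bullet> n = 0"
  with assms show "\<pi> \<in> separatrix C"
    by (auto simp: separatrix_def constant_on_def C_eq)
qed

lemma \<pi>star_n: "\<pi>star \<bullet> n = 0"
proof -
  have "\<pi>star \<in> separatrix C" using pair by (simp add: rank_one_pair_def)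
  then show ?thesis using separatrix_iff[of \<pi>star] by (simp add: separatrix_def)
qed

lemma strict_mono_C:
  assumes "\<pi> \<in> prob_simplex" "0 < \<epsilon> * (\<pi> \<bullet> n)"
  shows "strict_mono_on {0<..<1} (C \<pi>)"
proof (rule monotone_onI)
  fix x y :: real assume xy: "x \<in> {0<..<1}" "y \<in> {0<..<1}" "x < y"
  show "C \<pi> x < C \<pi> y"
  proof (rule DERIV_pos_imp_increasing[OF xy(3)])
    fix t assume "x \<le> t" "t \<le> y"
    with xy have "t \<in> {0<..<1}" by simp
    then obtain q where "0 < q" "(C \<pi> has_field_derivative \<epsilon> * (\<pi> \<bullet> n) * q) (at t)"
      by (rule C_derivative_sign[OF assms(1)])
    then show "\<exists>D. (C \<pi> has_field_derivative D) (at t) \<and> 0 < D"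
      using assms(2) by (intro exI conjI) (assumption, rule mult_pos_pos)
  qed
qed

lemma strict_antimono_C:
  assumes "\<pi> \<in> prob_simplex" "\<epsilon> * (\<pi> \<bullet> n) < 0"
  shows "strict_antimono_on {0<..<1} (C \<pi>)"
proof (rule monotone_onI)
  fix x y :: real assume xy: "x \<in> {0<..<1}" "y \<in> {0<..<1}" "x < y"
  show "C \<pi> y < C \<pi> x"
  proof (rule DERIV_neg_imp_decreasing[OF xy(3)])
    fix t assume "x \<le> t" "t \<le> y"
    with xy have "t \<in> {0<..<1}" by simp
    then obtain q where "0 < q" "(C \<pi> has_field_derivative \<epsilon> * (\<pi> \<bullet> n) * q) (at t)"
      by (rule C_derivative_sign[OF assms(1)])
    then show "\<exists>D. (C \<pi> has_field_derivative D) (at t) \<and> D < 0"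
      using assms(2) by (intro exI conjI) (assumption, rule mult_neg_pos)
  qed
qed

lemma sgn_deriv_C:
  assumes "\<pi> \<in> prob_simplex" "\<gamma> \<in> {0<..<1}"
  shows "sgn (deriv (C \<pi>) \<gamma>) = \<epsilon> * sgn (\<pi> \<bullet> n)"
proof -
  obtain q where q: "0 < q" "(C \<pi> has_field_derivative \<epsilon> * (\<pi> \<bullet> n) * q) (at \<gamma>)"
    by (rule C_derivative_sign[OF assms])
  have "sgn \<epsilon> = \<epsilon>" using \<epsilon>_cases by auto
  with q(1) show ?thesis unfolding DERIV_imp_deriv[OF q(2)] by (simp add: sgn_mult)
qed

text \<open>On the only orbit the coefficient is \<open>t * \<phi>\<close>, where \<open>n\<close>
  is \<open>t\<close> times the orbit vector. Its Wronskians are scaled by \<open>t\<close>, so the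
  common sign changes from \<open>\<epsilon>\<close> to \<open>sgn t * \<epsilon>\<close>.\<close>

lemma vertex_condition:
  assumes R: "orbit_reps \<sigma> R"
  shows "vertex_condition f A B \<sigma> \<kappa> K R"
proof -
  obtain a where a: "a \<in> R" "\<sigma> a \<noteq> a"
    using ex_orbit R unfolding orbit_reps_def by metis
  \<comment> \<open>Both representatives lie in the same orbit, which has exactly one.\<close>
  have "b = a" if "b \<in> R" for b
  proof -
    have "\<sigma> b \<noteq> b" using that R by (auto simp: orbit_reps_def)
    then have "b \<in> {a, \<sigma> a}" using single_orbit a(2) by blast
    moreover have "\<exists>!c. c \<in> R \<and> c \<in> {a, \<sigma> a}" using R a(2) by (auto simp: orbit_reps_def)
    ultimately show ?thesis using that a(1) by blast
  qed
  with a(1) have R_eq: "R = {a}" by blast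
  define t where "t = n $ a / sqrt (\<kappa> a)"
  have t: "t \<noteq> 0" using n_orbit[OF a(2)] \<kappa>_pos[of a] by (simp add: t_def)
  have wronskian_t: "wronskian (\<lambda>\<gamma>. t * \<phi> \<gamma>) (s z) \<gamma> = t * wronskian \<phi> (s z) \<gamma>"
    if "\<gamma> \<in> {0<..<1}" for \<gamma> z
    using DERIV_imp_deriv[OF DERIV_cmult[OF has_derivative_\<phi>[OF that], of t]]
    by (simp add: wronskian_def algebra_simps)
  have "0 < sgn t * \<epsilon> * wronskian (\<lambda>\<gamma>. t * \<phi> \<gamma>) (s z) \<gamma>" if "\<gamma> \<in> {0<..<1}" for \<gamma> z
  proof -
    have "0 < \<bar>t\<bar> * (\<epsilon> * wronskian \<phi> (s z) \<gamma>)"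
      using t by (intro mult_pos_pos[OF _ wronskian_sign[OF that]]) simp
    then show ?thesis by (simp add: wronskian_t[OF that] abs_sgn mult_ac)
  qed
  moreover have "sgn t * \<epsilon> \<in> {-1, 1}" using \<epsilon>_cases t by (auto simp: sgn_if)
  moreover have "response f A B K \<gamma> = (t * \<phi> \<gamma>) *\<^sub>R orbit_vector \<sigma> \<kappa> a" if "\<gamma> \<in> {0<..<1}" for \<gamma>
    using response_eq[OF that] n_eq_orbit_vector[OF a(2), folded t_def]
    by (metis mult.commute scaleR_scaleR)
  ultimately show ?thesis
    unfolding vertex_condition_def R_eq
    by (intro exI[of _ "\<lambda>_ \<gamma>. t * \<phi> \<gamma>"] conjI bexI[of _ "sgn t * \<epsilon>"]) auto
qed

end

section \<open>A pair satisfying only the vertex condition\<close>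

text \<open>One orbit \<open>{1, 2}\<close> and the neutral site \<open>3\<close>, with \<open>s\<^sub>1 = s\<^sub>2 = 2\<close> and \<open>s\<^sub>3 = 2 \<gamma>\<^sup>2\<close>.
  The response is \<open>\<gamma> (1, -1, 0)\<close>, so its Wronskian is \<open>2\<close> on the orbit and \<open>- 2 \<gamma>\<^sup>2\<close> at the
  neutral site.\<close>

definition ex_f :: "3 \<Rightarrow> real \<Rightarrow> real" where
  "ex_f \<nu> \<gamma> = (if \<nu> = 1 then 1 + \<gamma> else if \<nu> = 2 then 1 - \<gamma> else \<gamma>\<^sup>2)"

text \<open>The identity matrix has full column rank and makes each \<open>u z\<close> equal to
  \<open>ex_f z\<close>.\<close>

definition ex_A :: "real ^ 3 ^ 3" where
  "ex_A = mat 1"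

definition ex_\<sigma> :: "3 \<Rightarrow> 3" where
  "ex_\<sigma> z = (if z = 1 then 2 else if z = 2 then 1 else z)"

definition ex_B :: "real ^ 3 ^ 3" where
  "ex_B = (\<chi> \<nu> z. ex_A $ \<nu> $ ex_\<sigma> z)"

text \<open>An explicit quotient that makes sense off the simplex, so it serves as its own smooth
  extension.\<close>

definition ex_C :: "real ^ 3 \<Rightarrow> real \<Rightarrow> real" where
  "ex_C \<pi> \<gamma> = (\<pi> $ 1 * (1 + \<gamma>) + \<pi> $ 2 * (1 - \<gamma>) + \<pi> $ 3 * \<gamma>\<^sup>2) / (2 * (\<pi> $ 1 + \<pi> $ 2 + \<pi> $ 3 * \<gamma>\<^sup>2))"

definition ex_n :: "real ^ 3" where
  "ex_n = vector [1, -1, 0]"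

lemma ex_site_u: "site_u ex_f ex_A z = ex_f z"
  by (auto simp: site_u_def ex_A_def mat_def fun_eq_iff if_distrib[of "\<lambda>x. _ * x"] cong: if_cong)

lemma ex_site_s: "site_s ex_f ex_A ex_B z = (\<lambda>\<gamma>. ex_f z \<gamma> + ex_f (ex_\<sigma> z) \<gamma>)"
  by (auto simp: site_s_def ex_A_def ex_B_def mat_def fun_eq_iff distrib_left sum.distrib
      if_distrib[of "\<lambda>x. _ * x"] cong: if_cong)

lemma ex_site_s_simps:
  "site_s ex_f ex_A ex_B 1 = (\<lambda>\<gamma>. 2)"
  "site_s ex_f ex_A ex_B 2 = (\<lambda>\<gamma>. 2)"
  "site_s ex_f ex_A ex_B 3 = (\<lambda>\<gamma>. 2 * \<gamma>\<^sup>2)"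
  by (auto simp: ex_site_s ex_f_def ex_\<sigma>_def)

lemma ex_denominator_pos:
  fixes \<pi> :: "real ^ 3"
  assumes "\<pi> \<in> prob_simplex" "\<gamma> \<in> {0<..<1}"
  shows "0 < \<pi> $ 1 + \<pi> $ 2 + \<pi> $ 3 * \<gamma>\<^sup>2"
proof -
  have p: "0 \<le> \<pi> $ 1" "0 \<le> \<pi> $ 2" "0 \<le> \<pi> $ 3" "\<pi> $ 1 + \<pi> $ 2 + \<pi> $ 3 = 1"
    using assms(1) by (simp_all add: prob_simplex_def sum_3)
  show ?thesis
  proof (cases "\<pi> $ 3 = 0")
    case False
    then have "0 < \<pi> $ 3 * \<gamma>\<^sup>2" using p assms(2) by (intro mult_pos_pos) auto
    then show ?thesis using p by linarith
  qed (use p in simp)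
qed

text \<open>Kept general in the coordinate functions: with \<open>g\<close> the projection to
  \<gamma> it yields joint smoothness, with \<open>g\<close> constant the regularity in \<pi>
  alone.\<close>

lemma ex_Ck_open:
  fixes p1 p2 p3 g :: "'a::euclidean_space \<Rightarrow> real"
  assumes U: "open U" and c: "Ck_open k U p1" "Ck_open k U p2" "Ck_open k U p3" "Ck_open k U g"
    and nz: "\<And>x. x \<in> U \<Longrightarrow> p1 x + p2 x + p3 x * (g x)\<^sup>2 \<noteq> 0"
  shows "Ck_open k U (\<lambda>x. (p1 x * (1 + g x) + p2 x * (1 - g x) + p3 x * (g x)\<^sup>2) /
           (2 * (p1 x + p2 x + p3 x * (g x)\<^sup>2)))"
proof -
  note intros = Ck_open_add[OF U] Ck_open_mult[OF U] Ck_open_const[OF U] c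
  \<comment> \<open>Differences and squares are rewritten through sums and products, to which the
    closure rules apply.\<close>
  have "Ck_open k U (\<lambda>x. (p1 x * (1 + g x) + p2 x * (1 + (-1) * g x) + p3 x * (g x * g x)) /
           (2 * (p1 x + p2 x + p3 x * (g x * g x))))"
    by (rule Ck_open_divide[OF U]; (intro intros)?) (use nz in \<open>simp add: power2_eq_square del: distrib_left_numeral\<close>)
  then show ?thesis by (simp add: power2_eq_square)
qed

lemma ex_smooth: "smooth_on (prob_simplex \<times> {0<..<1}) (\<lambda>(\<pi>, \<gamma>). ex_C \<pi> \<gamma>)"
proof -
  define U :: "((real ^ 3) \<times> real) set" where
    "U = {p. fst p $ 1 + fst p $ 2 + fst p $ 3 * (snd p)\<^sup>2 \<noteq> 0}"
  have U: "open U"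
    unfolding U_def by (intro open_Collect_neq continuous_intros)
  have "Ck_open k U (\<lambda>p. ex_C (fst p) (snd p))" for k
    unfolding ex_C_def
    by (intro ex_Ck_open U Ck_open_linear bounded_linear_snd
        bounded_linear_compose[OF bounded_linear_vec_nth bounded_linear_fst]) (simp add: U_def)
  moreover have "prob_simplex \<times> {0<..<1} \<subseteq> U"
    using ex_denominator_pos by (fastforce simp: U_def)
  ultimately show ?thesis
    unfolding smooth_on_def using U
    by (intro exI[of _ U] exI[of _ "\<lambda>p. ex_C (fst p) (snd p)"]) (auto simp: split_beta)
qed

text \<open>The cases k = 1 and k = 0 supply the two halves of \<open>S1\<close>.\<close>

lemma ex_Ck_on:
  assumes "\<gamma> \<in> {0<..<1}"
  shows "Ck_on k prob_simplex (\<lambda>\<pi>. ex_C \<pi> \<gamma>)"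
proof -
  define U :: "(real ^ 3) set" where
    "U = {\<pi>. \<pi> $ 1 + \<pi> $ 2 + \<pi> $ 3 * \<gamma>\<^sup>2 \<noteq> 0}"
  have U: "open U"
    unfolding U_def by (intro open_Collect_neq continuous_intros)
  have "Ck_open k U (\<lambda>\<pi>. ex_C \<pi> \<gamma>)"
    unfolding ex_C_def
    by (intro ex_Ck_open U Ck_open_linear Ck_open_const bounded_linear_vec_nth) (simp add: U_def)
  moreover have "prob_simplex \<subseteq> U"
    using ex_denominator_pos[OF _ assms] by (fastforce simp: U_def)
  ultimately show ?thesis
    unfolding Ck_on_def using U by blast
qed

lemma ex_S1: "S1 ex_C"
  unfolding S1_def
proof (intro ballI conjI)
  fix \<gamma> :: real assume \<gamma>: "\<gamma> \<in> {0<..<1}"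
  have "open_simplex \<subseteq> (prob_simplex :: (real ^ 3) set)"
    by (auto simp: open_simplex_def prob_simplex_def less_imp_le)
  then show "Ck_on 1 open_simplex (\<lambda>\<pi>. ex_C \<pi> \<gamma>)"
    using ex_Ck_on[OF \<gamma>, of 1] unfolding Ck_on_def by blast
  obtain U g where "prob_simplex \<subseteq> U" "continuous_on U g" "\<And>\<pi>. \<pi> \<in> prob_simplex \<Longrightarrow> g \<pi> = ex_C \<pi> \<gamma>"
    using ex_Ck_on[OF \<gamma>, of 0] unfolding Ck_on_def by auto
  then show "continuous_on prob_simplex (\<lambda>\<pi>. ex_C \<pi> \<gamma>)"
    using continuous_on_subset by (metis continuous_on_cong)
qed

section \<open>The remaining structural conditions of the example\<close>

lemma ex_f_independent:
  assumes "\<forall>\<gamma>\<in>{0<..<1}. (\<Sum>\<nu>\<in>UNIV. c \<nu> * ex_f \<nu> \<gamma>) = 0"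
  shows "c \<nu> = 0"
proof -
  have e: "c 1 * (1 + \<gamma>) + c 2 * (1 - \<gamma>) + c 3 * \<gamma>\<^sup>2 = 0" if "0 < \<gamma>" "\<gamma> < 1" for \<gamma>
    using assms that by (auto simp: sum_3 ex_f_def)
  have "c 1 = 0 \<and> c 2 = 0 \<and> c 3 = 0"
    \<comment> \<open>A polynomial of degree at most 2 with three distinct roots is zero; its
      coefficients are c1 + c2, c1 - c2 and c3.\<close>
    using e[of "1/2"] e[of "1/4"] e[of "3/4"] by (simp add: power2_eq_square)
  then show ?thesis using exhaust_3[of \<nu>] by auto
qed

lemma ex_S2: "S2 ex_C ex_f ex_A ex_B"
  unfolding S2_def
proof (intro conjI ballI allI impI)
  fix \<pi> :: "real ^ 3" and \<gamma> :: real assume *: "\<pi> \<in> prob_simplex" "\<gamma> \<in> {0<..<1}"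
  have s: "(\<Sum>z\<in>UNIV. \<pi> $ z * site_s ex_f ex_A ex_B z \<gamma>) = 2 * (\<pi> $ 1 + \<pi> $ 2 + \<pi> $ 3 * \<gamma>\<^sup>2)"
    by (simp add: sum_3 ex_site_s_simps)
  show "0 < (\<Sum>z\<in>UNIV. \<pi> $ z * site_s ex_f ex_A ex_B z \<gamma>)"
    unfolding s using ex_denominator_pos[OF *] by simp
  show "ex_C \<pi> \<gamma> = (\<Sum>z\<in>UNIV. \<pi> $ z * site_u ex_f ex_A z \<gamma>) / (\<Sum>z\<in>UNIV. \<pi> $ z * site_s ex_f ex_A ex_B z \<gamma>)"
    unfolding s by (simp add: sum_3 ex_site_u ex_f_def ex_C_def)
next
  fix \<nu> :: 3
  have "ex_f \<nu> = (\<lambda>y. 1 + 1 * y + 0 * y\<^sup>2) \<or> ex_f \<nu> = (\<lambda>y. 1 + (-1) * y + 0 * y\<^sup>2)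
      \<or> ex_f \<nu> = (\<lambda>y. 0 + 0 * y + 1 * y\<^sup>2)"
    using exhaust_3[of \<nu>] by (auto simp: ex_f_def fun_eq_iff)
  then show "real_analytic_on (ex_f \<nu>) {0<..<1}"
    by (elim disjE) (simp_all only: real_analytic_on_quadratic)
next
  show "rank ex_A = CARD(3)" by (simp only: ex_A_def rank_I)
qed (use ex_f_independent in auto)

lemma ex_S3: "S3 ex_A ex_B ex_\<sigma> (\<lambda>_. 1)"
  by (auto simp: S3_def ex_B_def ex_\<sigma>_def intro!: exI[of _ 1])

text \<open>Here K = 1 and \<open>C_star 1\<close> is 1/2, so each component is half the difference
  of \<open>u\<close> at the site and at its partner.\<close>

lemma ex_response: "response ex_f ex_A ex_B 1 \<gamma> = \<gamma> *\<^sub>R ex_n"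
  by (simp add: vec_eq_iff forall_3 response_def C_star_def ex_site_u ex_site_s_simps ex_n_def ex_f_def field_simps)

lemma ex_response_space: "response_space ex_f ex_A ex_B 1 = span {ex_n}"
proof (rule antisym)
  show "response_space ex_f ex_A ex_B 1 \<subseteq> span {ex_n}"
    unfolding response_space_def by (rule span_minimal) (auto simp: ex_response span_base span_scale)
  \<comment> \<open>The response at \<gamma> = 1/2 is half of \<open>ex_n\<close>.\<close>
  have "2 *\<^sub>R ((1/2) *\<^sub>R ex_n) \<in> response_space ex_f ex_A ex_B 1"
    unfolding response_space_def
    by (intro span_scale span_base) (auto simp: ex_response image_iff intro!: bexI[of _ "1/2"])
  then have "ex_n \<in> response_space ex_f ex_A ex_B 1" by simp
  then show "span {ex_n} \<subseteq> response_space ex_f ex_A ex_B 1"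
    unfolding response_space_def by (simp add: span_minimal)
qed

lemma ex_rank_one: "rank_one_pair ex_C ex_f ex_A ex_B ex_\<sigma> (\<lambda>_. 1) 1 (\<chi> z. 1/3) ex_n (\<lambda>\<gamma>. \<gamma>)"
proof -
  have "ex_n \<noteq> 0" by (auto simp: ex_n_def vec_eq_iff forall_3)
  then have "dim (response_space ex_f ex_A ex_B 1) = 1"
    unfolding ex_response_space by simp
  moreover have "(\<chi> z. 1/3) \<in> separatrix ex_C"
  proof -
    have "ex_C (\<chi> z. 1/3) \<gamma> = 1/2" for \<gamma>
    proof -
      \<comment> \<open>Nine times the denominator at the uniform distribution, in the form that
        arises when fractions are cleared.\<close>
      have "12 + 6 * \<gamma>\<^sup>2 \<noteq> 0" using zero_le_power2[of \<gamma>] by linarith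
      then show ?thesis unfolding ex_C_def by (simp add: field_simps)
    qed
    then show ?thesis by (auto simp: separatrix_def prob_simplex_def constant_on_def intro!: exI[of _ "1/2"])
  qed
  moreover have "(\<chi> z. 1/3) \<in> (open_simplex :: (real ^ 3) set)"
    by (simp add: open_simplex_def)
  ultimately show ?thesis
    unfolding rank_one_pair_def structured_pair_def
    using ex_smooth ex_S1 ex_S2 ex_S3 by (simp add: S4_def ex_response_space ex_response)
qed

section \<open>The example meets the vertex condition but not the all-site condition\<close>

lemma ex_wronskian:
  "wronskian (\<lambda>\<gamma>. \<gamma>) (site_s ex_f ex_A ex_B 1) \<gamma> = 2"
  "wronskian (\<lambda>\<gamma>. \<gamma>) (site_s ex_f ex_A ex_B 2) \<gamma> = 2"
  "wronskian (\<lambda>\<gamma>. \<gamma>) (site_s ex_f ex_A ex_B 3) \<gamma> = - 2 * \<gamma>\<^sup>2"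
proof -
  have "((\<lambda>\<gamma>. 2 * \<gamma>\<^sup>2) has_field_derivative 4 * \<gamma>) (at \<gamma>)"
    by (auto intro!: derivative_eq_intros)
  then have "deriv (\<lambda>\<gamma>. 2 * \<gamma>\<^sup>2) \<gamma> = 4 * \<gamma>" by (rule DERIV_imp_deriv)
  then show "wronskian (\<lambda>\<gamma>. \<gamma>) (site_s ex_f ex_A ex_B 3) \<gamma> = - 2 * \<gamma>\<^sup>2"
    by (simp add: wronskian_def ex_site_s_simps power2_eq_square)
qed (simp_all add: wronskian_def ex_site_s_simps)

lemma ex_orbit_reps: "orbit_reps ex_\<sigma> {1}"
  unfolding orbit_reps_def forall_3 by (auto simp: ex_\<sigma>_def)

lemma ex_vertex_condition: "vertex_condition ex_f ex_A ex_B ex_\<sigma> (\<lambda>_. 1) 1 {1}"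
proof -
  have "orbit_vector ex_\<sigma> (\<lambda>_. 1) 1 = ex_n"
    by (simp add: orbit_vector_def ex_n_def ex_\<sigma>_def vec_eq_iff forall_3)
  then show ?thesis
    unfolding vertex_condition_def
    by (intro exI[of _ "\<lambda>_ \<gamma>. \<gamma>"] conjI bexI[of _ 1])
      (auto simp: ex_response ex_wronskian ex_\<sigma>_def)
qed

lemma ex_not_all_site: "\<not> all_site_condition ex_f ex_A ex_B (\<lambda>\<gamma>. \<gamma>) \<epsilon>"
proof
  assume "all_site_condition ex_f ex_A ex_B (\<lambda>\<gamma>. \<gamma>) \<epsilon>"
  then have "0 < \<epsilon> * wronskian (\<lambda>\<gamma>. \<gamma>) (site_s ex_f ex_A ex_B z) (1/2)" for z
    by (auto simp: all_site_condition_def)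
  \<comment> \<open>The Wronskians 2 and -1/2 require opposite signs of
    \<open>\<epsilon>\<close>.\<close>
  from this[of 1] this[of 3] show False by (simp add: ex_wronskian power2_eq_square)
qed

section \<open>Orientation of the simplex by the separatrix\<close>

theorem proposition6p12:
  fixes C :: "real ^ 'z::finite \<Rightarrow> real \<Rightarrow> real"
    and f :: "'n::finite \<Rightarrow> real \<Rightarrow> real"
    and A B :: "real ^ 'z ^ 'n"
    and \<sigma> :: "'z \<Rightarrow> 'z"
    and \<kappa> :: "'z \<Rightarrow> real"
    and K \<epsilon> :: real
    and \<pi>star n :: "real ^ 'z"
    and \<phi> :: "real \<Rightarrow> real"
  assumes "rank_one_pair C f A B \<sigma> \<kappa> K \<pi>star n \<phi>"
    and "all_site_condition f A B \<phi> \<epsilon>"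
  shows "(\<forall>\<pi>\<in>open_simplex. \<forall>\<gamma>\<in>{0<..<1}.
            sgn (deriv (C \<pi>) \<gamma>) = \<epsilon> * sgn ((\<pi> - \<pi>star) \<bullet> n)) \<and>
         (\<forall>\<pi>\<in>prob_simplex - separatrix C.
            strict_mono_on {0<..<1} (C \<pi>) \<or> strict_antimono_on {0<..<1} (C \<pi>)) \<and>
         (\<forall>\<pi>\<in>prob_simplex.
            (0 < \<epsilon> * ((\<pi> - \<pi>star) \<bullet> n) \<longrightarrow> strict_mono_on {0<..<1} (C \<pi>)) \<and>
            (\<epsilon> * ((\<pi> - \<pi>star) \<bullet> n) < 0 \<longrightarrow> strict_antimono_on {0<..<1} (C \<pi>))) \<and>
         (\<forall>\<pi>\<in>separatrix C. C \<pi> constant_on {0<..<1}) \<and>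
         affine {\<pi>. (\<pi> - \<pi>star) \<bullet> n = 0} \<and>
         aff_dim {\<pi>. (\<pi> - \<pi>star) \<bullet> n = 0} = int CARD('z) - 1 \<and>
         separatrix C = {\<pi> \<in> prob_simplex. (\<pi> - \<pi>star) \<bullet> n = 0} \<and>
         single_orientation C \<pi>star \<and>
         (\<forall>R. orbit_reps \<sigma> R \<longrightarrow> vertex_condition f A B \<sigma> \<kappa> K R) \<and>
         (\<exists>(C' :: real ^ 3 \<Rightarrow> real \<Rightarrow> real) (f' :: 3 \<Rightarrow> real \<Rightarrow> real) A' B' \<sigma>' \<kappa>' K' \<pi>star' n' \<phi>' R'.
            rank_one_pair C' f' A' B' \<sigma>' \<kappa>' K' \<pi>star' n' \<phi>' \<and>
            orbit_reps \<sigma>' R' \<and> vertex_condition f' A' B' \<sigma>' \<kappa>' K' R' \<and>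
            \<not> (\<exists>\<epsilon>'. all_site_condition f' A' B' \<phi>' \<epsilon>'))"
proof -
  interpret oriented_rank_one C f A B \<sigma> \<kappa> K \<pi>star n \<phi> \<epsilon>
    using assms by unfold_locales
  have shift: "(\<pi> - \<pi>star) \<bullet> n = \<pi> \<bullet> n" for \<pi>
    by (simp add: inner_diff_left \<pi>star_n)
  have open_subset: "\<pi> \<in> prob_simplex" if "\<pi> \<in> open_simplex" for \<pi> :: "real ^ 'z"
    using that by (auto simp: open_simplex_def prob_simplex_def less_imp_le)
  have hyperplane: "{\<pi>. (\<pi> - \<pi>star) \<bullet> n = 0} = {\<pi>. n \<bullet> \<pi> = 0}"
    unfolding shift by (simp add: inner_commute)
  have separatrix_eq: "separatrix C = {\<pi> \<in> prob_simplex. \<pi> \<bullet> n = 0}"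
    using separatrix_iff by (auto simp: separatrix_def)
  have mono: "strict_mono_on {0<..<1} (C \<pi>) \<or> strict_antimono_on {0<..<1} (C \<pi>)"
    if "\<pi> \<in> prob_simplex - separatrix C" for \<pi>
  proof -
    have "\<pi> \<in> prob_simplex" "\<epsilon> * (\<pi> \<bullet> n) \<noteq> 0"
      using that \<epsilon>_cases separatrix_iff[of \<pi>] by auto
    then show ?thesis
      using strict_mono_C strict_antimono_C by (meson linorder_neqE_linordered_idom)
  qed
  have orientation: "single_orientation C \<pi>star"
    unfolding single_orientation_def
  \<comment> \<open>The sign \<open>\<epsilon>\<close> is absorbed into the covector; being nonzero,
    it leaves the hyperplane unchanged.\<close>
  proof (intro exI[of _ "\<epsilon> *\<^sub>R n"] conjI ballI)
    show "\<epsilon> *\<^sub>R n \<noteq> 0" using \<epsilon>_cases n_nonzero by auto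
    show "separatrix C = {\<pi> \<in> prob_simplex. (\<pi> - \<pi>star) \<bullet> \<epsilon> *\<^sub>R n = 0}"
      using \<epsilon>_cases by (auto simp: shift separatrix_eq)
    show "sgn (deriv (C \<pi>) \<gamma>) = sgn ((\<pi> - \<pi>star) \<bullet> \<epsilon> *\<^sub>R n)"
      if "\<pi> \<in> open_simplex" "\<gamma> \<in> {0<..<1}" for \<pi> \<gamma>
      using \<epsilon>_cases sgn_deriv_C[OF open_subset[OF that(1)] that(2)]
      by (auto simp: shift sgn_minus)
  qed
  show ?thesis
  proof (intro conjI)
    show "affine {\<pi>. (\<pi> - \<pi>star) \<bullet> n = 0}"
      unfolding hyperplane by (rule affine_hyperplane)
    show "aff_dim {\<pi>. (\<pi> - \<pi>star) \<bullet> n = 0} = int CARD('z) - 1"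
      unfolding hyperplane using n_nonzero by simp
    \<comment> \<open>Strictness of the comparison with the vertex condition, witnessed by the
      three-site pair.\<close>
    show "\<exists>(C' :: real ^ 3 \<Rightarrow> real \<Rightarrow> real) (f' :: 3 \<Rightarrow> real \<Rightarrow> real) A' B' \<sigma>' \<kappa>' K' \<pi>star' n' \<phi>' R'.
        rank_one_pair C' f' A' B' \<sigma>' \<kappa>' K' \<pi>star' n' \<phi>' \<and>
        orbit_reps \<sigma>' R' \<and> vertex_condition f' A' B' \<sigma>' \<kappa>' K' R' \<and>
        \<not> (\<exists>\<epsilon>'. all_site_condition f' A' B' \<phi>' \<epsilon>')"
      using ex_rank_one ex_orbit_reps ex_vertex_condition ex_not_all_site by blast
    show "separatrix C = {\<pi> \<in> prob_simplex. (\<pi> - \<pi>star) \<bullet> n = 0}"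
      unfolding shift by (rule separatrix_eq)
    show "\<forall>\<pi>\<in>separatrix C. C \<pi> constant_on {0<..<1}"
      by (simp add: separatrix_def)
    show "\<forall>\<pi>\<in>prob_simplex - separatrix C.
        strict_mono_on {0<..<1} (C \<pi>) \<or> strict_antimono_on {0<..<1} (C \<pi>)"
      using mono by blast
  qed (use sgn_deriv_C open_subset strict_mono_C strict_antimono_C orientation vertex_condition in
      \<open>auto simp: shift\<close>)
qed

end
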